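(* Let $n\ge 1$ be an integer. (i) Suppose that $I_1,I_2,J_1,J_2\subset\mathbb{N}_0^n$ are initial segments such that $|I_1|+|I_2|=|J_1|+|J_2|$, $|J_1|\le|I_1|\le|I_2|\le|J_2|$, and $J_2$ is closed. Then $$\sigma_n(J_1)+\sigma_n(J_2)\le\sigma_n(I_1)+\sigma_n(I_2).$$ (ii) If $I,I_1,I_2\subset\mathbb{N}_0^n$ are non-empty initial segments such that $|I|=|I_1|+|I_2|$, then $$\sigma_n(I)<\sigma_n(I_1)+\sigma_n(I_2).$$ (iii) If $n\ge 2$ and $I_{n-1}\subset\mathbb{N}_0^{n-1}$, $I_n\subset\mathbb{N}_0^n$ are non-empty initial segments such that $|I_{n-1}|=|I_n|$, then $$\sigma_n(I_n)>\sigma_{n-1}(I_{n-1}).$$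
   Context: $\mathbb{N}_0$ denotes the set of all non-negative integers, and $[a,b]$ denotes the set of integers from $a$ to $b$. For $n\ge 1$ and $i\in[1,n]$, $\pi_i$ is the orthogonal projection of $\mathbb{R}^n$ onto the coordinate hyperplane $\{(x_1,\ldots,x_n)\in\mathbb{R}^n : x_i=0\}$ (for $n=1$ the projection of any nonempty set has size $1$). For a finite set $A\subset\mathbb{R}^n$ let $\sigma_n(A):=\sum_{i=1}^n|\pi_i(A)|$. The cube order on $\mathbb{N}_0^n$ is the linear order in which $(x_1,\ldots,x_n)$ precedes $(y_1,\ldots,y_n)$ if there exist $l_0\in\mathbb{N}_0$ and $j\in[1,n]$ such that $\{i\in[1,n]: x_i=l\}=\{i\in[1,n]: y_i=l\}$ for each $l>l_0$, and also $\{i\in[j+1,n]: x_i=l_0\}=\{i\in[j+1,n]: y_i=l_0\}$, while $x_j<y_j=l_0$. "Initial segment" always means a finite (possibly empty) initial segment of $\mathbb{N}_0^n$ with respect to the cube order; for each integer $m\ge 0$ there is exactly one of size $m$, denoted $\mathcal{I}_n(m)$. An initial segment $\mathcal{I}_n(m)$ is called closed if $m=(K+1)^iK^{n-i}$ for some integers $K\ge 1$ and $i\in[0,n-1]$; in this case $\mathcal{I}_n(m)=\{(x_1,\ldots,x_n)\in\mathbb{N}_0^n : 0\le x_1,\ldots,x_i\le K,\ 0\le x_{i+1},\ldots,x_n\le K-1\}$ is an axes-aligned rectangular parallelepiped. *)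

theory Defs
  imports Main
begin

text \<open>
  A point of an \<open>n\<close>-dimensional space is a function on \<^typ>\<open>nat\<close> vanishing outside the index
  set \<open>{1..n}\<close>, so that spaces of different dimensions share one type.
\<close>

definition lattice_points :: "nat \<Rightarrow> (nat \<Rightarrow> nat) set" where
  "lattice_points n = {x. \<forall>i. i \<notin> {1..n} \<longrightarrow> x i = 0}"

text \<open>
  The coordinate type is left generic. The embedding of the lattice points into real space is
  injective and commutes with the projections, so the cardinalities below do not depend on whether
  coordinates are read in \<^typ>\<open>nat\<close> or in the reals.
\<close>

definition coord_proj :: "nat \<Rightarrow> (nat \<Rightarrow> 'a::zero) \<Rightarrow> (nat \<Rightarrow> 'a)" where
  "coord_proj i x = x(i := 0)"

definition proj_sum :: "nat \<Rightarrow> (nat \<Rightarrow> 'a::zero) set \<Rightarrow> nat" where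
  "proj_sum n A = (\<Sum>i = 1..n. card (coord_proj i ` A))"

definition cube_less :: "nat \<Rightarrow> (nat \<Rightarrow> nat) \<Rightarrow> (nat \<Rightarrow> nat) \<Rightarrow> bool" where
  "cube_less n x y \<longleftrightarrow>
    (\<exists>l0. \<exists>j\<in>{1..n}.
      (\<forall>l>l0. {i \<in> {1..n}. x i = l} = {i \<in> {1..n}. y i = l}) \<and>
      {i \<in> {j+1..n}. x i = l0} = {i \<in> {j+1..n}. y i = l0} \<and>
      x j < y j \<and> y j = l0)"

definition initial_segment :: "nat \<Rightarrow> (nat \<Rightarrow> nat) set \<Rightarrow> bool" where
  "initial_segment n I \<longleftrightarrow>
    finite I \<and> I \<subseteq> lattice_points n \<and>
    (\<forall>y\<in>I. \<forall>x\<in>lattice_points n. cube_less n x y \<longrightarrow> x \<in> I)"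

definition closed_initial_segment :: "nat \<Rightarrow> (nat \<Rightarrow> nat) set \<Rightarrow> bool" where
  "closed_initial_segment n I \<longleftrightarrow>
    initial_segment n I \<and>
    (\<exists>K i. 1 \<le> K \<and> i \<in> {0..n-1} \<and> card I = (K + 1) ^ i * K ^ (n - i))"

end

theory Submission
  imports Defs
begin

text \<open>
  An initial segment is closed downward in the coordinatewise order, so its projection along an
  axis is as large as its slice on the corresponding coordinate hyperplane. Hence the sum of the
  projections of a segment is the sum, over its points, of the number of vanishing coordinates
  (\<open>proj_sum_initial_segment\<close>). Write \<open>s n m\<close> for this sum when the segment has \<open>m\<close> points
  (\<open>seg_sum\<close>).

  The closed segments are boxes with side lengths \<open>K + 1\<close> (the first \<open>i\<close> of them) and \<open>K\<close>. After
  such a box of size \<open>c\<close> the cube order fills the face on which coordinate \<open>i + 1\<close> equals \<open>K\<close>, and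
  it does so in the cube order of dimension \<open>n - 1\<close>, until the next box is complete. As \<open>K \<ge> 1\<close>,
  the coordinate \<open>i + 1\<close> contributes no zeros there. So
  \<open>s n (c + r) = s n c + s (n - 1) r\<close> for all \<open>r\<close> up to the size \<open>f\<close> of the face
  (\<open>seg_sum_box_plus\<close>), and \<open>f\<close> is the size of a box of dimension \<open>n - 1\<close>. Together with
  \<open>s n 0 = 0\<close> and \<open>s n 1 = n\<close>, this recursion is all that is used about the geometry.

  List the points of the space in the cube order and attach to each its number of zeros; then
  \<open>s n (a + t) - s n a\<close> is the sum over a window of length \<open>t\<close>. In these terms part (i)
  (\<open>box_exchange\<close>) says that among the windows inside a box the last one has the least sum, and
  part (ii) that the first window has a larger sum than any other one of the same length. The parts
  are proved by induction on the dimension: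

  \<^item> Part (iii) in dimension \<open>n\<close> follows from the weak form of (ii) (\<open>subadditive\<close>) in dimension
    \<open>n - 1\<close>: if \<open>m = c + r\<close> as above, then
    \<open>s (n - 1) m \<le> s (n - 1) c + s (n - 1) r\<close>, and by induction on \<open>m\<close> this is less than
    \<open>s n c + s (n - 1) r = s n m\<close> (\<open>seg_sum_less_dim_Suc\<close>).

  \<^item> For part (i), a window is cut at the boundaries of the faces that it meets. Apart from the
    origin, all pieces are windows of dimension \<open>n - 1\<close>; the first one is bounded below by part (i), and the others, being
    initial windows of their faces, by part (ii), both in dimension \<open>n - 1\<close>
    (\<open>window_ge_tail\<close>, \<open>box_exchange_Suc\<close>).

  \<^item> For part (ii), write \<open>a + b = c + r\<close>. If both \<open>a\<close> and \<open>b\<close> are less than \<open>c\<close>, then part (i)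
    gives \<open>s n r + s n c \<le> s n a + s n b\<close>, and \<open>s (n - 1) r < s n r\<close> by part (iii). Otherwise the
    window to be compared lies in the last face, and part (ii) in dimension \<open>n - 1\<close> applies together
    with part (iii) (\<open>seg_sum_add_less\<close>).
\<close>

section \<open>The cube order\<close>

lemma cube_less_pointwise:
  "cube_less n x y \<longleftrightarrow>
    (\<exists>j\<in>{1..n}. x j < y j \<and>
      (\<forall>k\<in>{1..n}. y j < x k \<or> y j < y k \<longrightarrow> x k = y k) \<and>
      (\<forall>k\<in>{1..n}. j < k \<longrightarrow> (x k = y j \<longleftrightarrow> y k = y j)))"
  (is "_ \<longleftrightarrow> (\<exists>j\<in>_. ?Q j)")
proof -
  have above: "(\<forall>l>c. {i \<in> A. x i = l} = {i \<in> A. y i = l}) \<longleftrightarrow>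
      (\<forall>k\<in>A. c < x k \<or> c < y k \<longrightarrow> x k = y k)" (is "?L \<longleftrightarrow> ?R") for c A
  proof
    assume L: ?L
    show ?R
    proof (intro ballI impI)
      fix k assume "k \<in> A" "c < x k \<or> c < y k"
      then show "x k = y k"
      proof (elim disjE)
        assume "c < x k"
        with L \<open>k \<in> A\<close> have "k \<in> {i \<in> A. y i = x k}" by blast
        then show ?thesis by simp
      next
        assume "c < y k"
        with L \<open>k \<in> A\<close> have "k \<in> {i \<in> A. x i = y k}" by blast
        then show ?thesis by simp
      qed
    qed
  next
    assume R: ?R
    show ?L
    proof (intro allI impI set_eqI)
      fix l k assume "c < l"
      with R have "k \<in> A \<longrightarrow> x k = l \<or> y k = l \<longrightarrow> x k = y k" by blast
      then show "k \<in> {i \<in> A. x i = l} \<longleftrightarrow> k \<in> {i \<in> A. y i = l}" by auto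
    qed
  qed
  have at: "{i \<in> {j+1..n}. x i = c} = {i \<in> {j+1..n}. y i = c} \<longleftrightarrow>
      (\<forall>k\<in>{1..n}. j < k \<longrightarrow> (x k = c \<longleftrightarrow> y k = c))" (is "?L \<longleftrightarrow> ?R") for c j
  proof -
    have eq: "{j+1..n} = {k\<in>{1..n}. j < k}" by auto
    show ?thesis unfolding eq by blast
  qed
  have "cube_less n x y \<longleftrightarrow> (\<exists>l. \<exists>j\<in>{1..n}. l = y j \<and> ?Q j)"
    unfolding cube_less_def above at by (intro ex_cong1 bex_cong refl) auto
  also have "\<dots> \<longleftrightarrow> (\<exists>j\<in>{1..n}. ?Q j)" by blast
  finally show ?thesis .
qed

text \<open>
  The deciding level is the largest coordinate of \<open>y\<close> at a position where \<open>x\<close> is strictly smaller,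
  and the deciding position is the largest such position on that level.
\<close>

lemma cube_less_if_le:
  assumes xy: "x \<in> lattice_points n" "y \<in> lattice_points n"
    and le: "\<And>k. x k \<le> y k" and "x \<noteq> y"
  shows "cube_less n x y"
proof -
  define D where "D = {k\<in>{1..n}. x k < y k}"
  have "D \<noteq> {}"
  proof
    assume "D = {}"
    then have "x k = y k" for k
      using xy le[of k] unfolding D_def lattice_points_def by (cases "k \<in> {1..n}") force+
    with \<open>x \<noteq> y\<close> show False by blast
  qed
  have finD: "finite D" by (simp add: D_def)
  define l where "l = Max (y ` D)"
  define j where "j = Max {k\<in>D. y k = l}"
  have l: "l \<in> y ` D" "\<And>k. k \<in> D \<Longrightarrow> y k \<le> l"
    using finD \<open>D \<noteq> {}\<close> by (auto simp: l_def)
  then have ne: "{k\<in>D. y k = l} \<noteq> {}" by auto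
  have "j \<in> {k\<in>D. y k = l}" unfolding j_def using finD ne by (intro Max_in) auto
  then have j: "j \<in> D" "y j = l" by auto
  have jmax: "k \<le> j" if "k \<in> D" "y k = l" for k
    unfolding j_def using finD that by (intro Max_ge) auto
  show ?thesis
    unfolding cube_less_pointwise
  proof (intro bexI[of _ j] conjI ballI impI)
    show "x j < y j" "j \<in> {1..n}" using j by (auto simp: D_def)
  next
    fix k assume k: "k \<in> {1..n}" "y j < x k \<or> y j < y k"
    then have "k \<notin> D" using l(2)[of k] le[of k] j by force
    then show "x k = y k" using k le[of k] by (simp add: D_def)
  next
    fix k assume k: "k \<in> {1..n}" "j < k"
    show "(x k = y j) = (y k = y j)"
    proof (cases "k \<in> D")
      case True
      then have "x k < y k" "y k \<noteq> l" "y k \<le> l"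
        using jmax[of k] l(2)[of k] k by (auto simp: D_def)
      then show ?thesis using j by auto
    next
      case False
      then show ?thesis using k le[of k] by (simp add: D_def)
    qed
  qed
qed

text \<open>
  Two distinct points are compared at the largest value whose sets of positions differ, and there
  at the largest position in the symmetric difference of these two sets.
\<close>

lemma cube_less_total:
  assumes xy: "x \<in> lattice_points n" "y \<in> lattice_points n" and "x \<noteq> y"
  shows "cube_less n x y \<or> cube_less n y x"
proof -
  define D where "D = {k\<in>{1..n}. x k \<noteq> y k}"
  have finD: "finite D" by (simp add: D_def)
  have "D \<noteq> {}"
  proof
    assume "D = {}"
    then have "x k = y k" for k
      using xy unfolding D_def lattice_points_def by (cases "k \<in> {1..n}") force+
    with \<open>x \<noteq> y\<close> show False by blast
  qed
  define l where "l = Max ((\<lambda>k. max (x k) (y k)) ` D)"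
  define j where "j = Max {k\<in>D. max (x k) (y k) = l}"
  have "l \<in> (\<lambda>k. max (x k) (y k)) ` D"
    unfolding l_def using finD \<open>D \<noteq> {}\<close> by (intro Max_in) auto
  then have ne: "{k\<in>D. max (x k) (y k) = l} \<noteq> {}" by auto
  have lmax: "max (x k) (y k) \<le> l" if "k \<in> D" for k
    unfolding l_def using finD that by (intro Max_ge) auto
  have "j \<in> {k\<in>D. max (x k) (y k) = l}"
    unfolding j_def using finD ne by (intro Max_in) auto
  then have j: "j \<in> {1..n}" "x j \<noteq> y j" "max (x j) (y j) = l" by (auto simp: D_def)
  have jmax: "k \<le> j" if "k \<in> D" "max (x k) (y k) = l" for k
    unfolding j_def using finD that by (intro Max_ge) auto
  have above: "x k = y k" if "k \<in> {1..n}" "l < x k \<or> l < y k" for k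
  proof (rule ccontr)
    assume "x k \<noteq> y k"
    with that(1) have "k \<in> D" by (simp add: D_def)
    with lmax[of k] that(2) show False by auto
  qed
  have at: "x k = l \<longleftrightarrow> y k = l" if "k \<in> {1..n}" "j < k" for k
    using that lmax[of k] jmax[of k] by (cases "x k = y k") (auto simp: D_def max_def split: if_splits)
  show ?thesis
  proof (cases "x j < y j")
    case True
    then have "y j = l" using j by simp
    then have "cube_less n x y"
      unfolding cube_less_pointwise using True j above at by (intro bexI[of _ j]) auto
    then show ?thesis ..
  next
    case False
    then have "x j = l" "y j < x j" using j by auto
    have above': "y k = x k" if "k \<in> {1..n}" "x j < y k \<or> x j < x k" for k
      using above[of k] that \<open>x j = l\<close> by auto
    have "cube_less n y x"
      unfolding cube_less_pointwise using \<open>x j = l\<close> \<open>y j < x j\<close> j(1) above' at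
      by (intro bexI[of _ j]) auto
    then show ?thesis ..
  qed
qed

section \<open>Initial segments\<close>

lemma initial_segments_nested:
  assumes "initial_segment n I" "initial_segment n J"
  shows "I \<subseteq> J \<or> J \<subseteq> I"
proof (rule ccontr)
  assume "\<not> ?thesis"
  then obtain x y where "x \<in> I" "x \<notin> J" "y \<in> J" "y \<notin> I" by blast
  moreover from this have "cube_less n x y \<or> cube_less n y x"
    using assms by (intro cube_less_total) (auto simp: initial_segment_def)
  ultimately show False
    using assms by (meson initial_segment_def subsetD)
qed

lemma initial_segment_subset_if_card_le:
  assumes "initial_segment n I" "initial_segment n J" "card I \<le> card J"
  shows "I \<subseteq> J"
  using initial_segments_nested[OF assms(1,2)] assms
  by (metis card_seteq initial_segment_def order_refl)

lemma initial_segment_eq_if_card_eq: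
  assumes "initial_segment n I" "initial_segment n J" "card I = card J"
  shows "I = J"
  using initial_segment_subset_if_card_le assms by (metis order_refl subset_antisym)

lemma initial_segment_empty: "initial_segment n {}"
  by (simp add: initial_segment_def)

definition zero_count :: "nat \<Rightarrow> (nat \<Rightarrow> nat) \<Rightarrow> nat" where
  "zero_count n x = card {k\<in>{1..n}. x k = 0}"

text \<open>
  An initial segment contains with \<open>x\<close> every point below \<open>x\<close> in the coordinatewise order, so its
  projection along the \<open>k\<close>-th axis is its slice with vanishing \<open>k\<close>-th coordinate. This makes
  \<^const>\<open>proj_sum\<close> additive over the points of a segment.
\<close>

lemma proj_sum_initial_segment:
  assumes "initial_segment n I"
  shows "proj_sum n I = (\<Sum>x\<in>I. zero_count n x)"
proof -
  have fin: "finite I" and sub: "I \<subseteq> lattice_points n" using assms by (auto simp: initial_segment_def)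
  have proj: "coord_proj k ` I = {x\<in>I. x k = 0}" for k
  proof (intro equalityI subsetI)
    fix z assume "z \<in> coord_proj k ` I"
    then obtain x where x: "x \<in> I" "z = x(k := 0)" by (auto simp: coord_proj_def)
    then have "x \<in> lattice_points n" "z \<in> lattice_points n"
      using sub by (auto simp: lattice_points_def)
    moreover have "z k' \<le> x k'" for k' using x by simp
    ultimately have "z = x \<or> cube_less n z x"
      using cube_less_if_le[of z n x] by blast
    with \<open>z \<in> lattice_points n\<close> have "z \<in> I"
      using x assms by (auto simp: initial_segment_def)
    then show "z \<in> {x\<in>I. x k = 0}" using x by simp
  next
    fix x assume "x \<in> {x\<in>I. x k = 0}"
    then have "x \<in> I" "coord_proj k x = x" by (auto simp: coord_proj_def fun_upd_idem)
    then show "x \<in> coord_proj k ` I" by force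
  qed
  have "proj_sum n I = (\<Sum>k = 1..n. \<Sum>x\<in>I. if x k = 0 then 1 else 0)"
    unfolding proj_sum_def proj using fin by (simp add: sum.If_cases Int_def)
  also have "\<dots> = (\<Sum>x\<in>I. \<Sum>k = 1..n. if x k = 0 then 1 else 0)"
    by (rule sum.swap)
  also have "\<dots> = (\<Sum>x\<in>I. zero_count n x)"
    unfolding zero_count_def by (simp add: sum.If_cases Int_def)
  finally show ?thesis .
qed

section \<open>Boxes\<close>

definition box :: "nat \<Rightarrow> nat \<Rightarrow> nat \<Rightarrow> (nat \<Rightarrow> nat) set" where
  "box n K i = {x \<in> lattice_points n. \<forall>k\<in>{1..n}. x k < (if k \<le> i then Suc K else K)}"

definition box_size :: "nat \<Rightarrow> nat \<Rightarrow> nat \<Rightarrow> nat" where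
  "box_size n K i = (K + 1) ^ i * K ^ (n - i)"

text \<open>
  Induction along the increasing chain of boxes. The value \<open>i = n\<close> lists the cube with side \<open>K + 1\<close>
  a second time, so that the steps that add a face all have the same form and \<open>carry\<close> only renames
  a box.
\<close>

lemma box_induct [consumes 2, case_names start grow carry]:
  assumes "1 \<le> K" "i \<le> n"
    and start: "P 1 0"
    and grow: "\<And>K i. 1 \<le> K \<Longrightarrow> i < n \<Longrightarrow> P K i \<Longrightarrow> P K (Suc i)"
    and carry: "\<And>K. 1 \<le> K \<Longrightarrow> P K n \<Longrightarrow> P (Suc K) 0"
  shows "P K i"
  using assms(1,2)
proof (induction K arbitrary: i rule: nat_induct_at_least)
  case base
  then show ?case by (induction i) (auto intro: start[unfolded One_nat_def] grow)
next
  case (Suc K)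
  from Suc.prems show ?case
    by (induction i) (use Suc in \<open>auto intro: carry grow\<close>)
qed

lemma box_full: "box n K n = box n (Suc K) 0"
  by (auto simp: box_def)

lemma box_size_full: "box_size n K n = box_size n (Suc K) 0"
  by (simp add: box_size_def)

lemma box_size_1: "box_size n 1 0 = 1"
  by (simp add: box_size_def)

lemma box_size_Suc:
  assumes "i \<le> n"
  shows "box_size (Suc n) K (Suc i) = box_size (Suc n) K i + box_size n K i"
  using assms by (simp add: box_size_def Suc_diff_le algebra_simps)

lemma box_size_le_Suc:
  assumes "i < n"
  shows "box_size n K i \<le> box_size n K (Suc i)"
  using assms box_size_Suc[of i "n - 1" K] by simp

lemma le_box_size_imp_box_plus:
  assumes "1 \<le> K" "i \<le> Suc n" "1 < m" "m \<le> box_size (Suc n) K i"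
  shows "\<exists>K\<ge>1. \<exists>i\<le>n. \<exists>r\<ge>1. r \<le> box_size n K i \<and> m = box_size (Suc n) K i + r"
  using assms
proof (induction K i rule: box_induct)
  case start
  then show ?case using box_size_1 by simp
next
  case (grow K i)
  show ?case
  proof (cases "m \<le> box_size (Suc n) K i")
    case True
    then show ?thesis using grow by blast
  next
    case False
    then show ?thesis
      using grow box_size_Suc[of i n K]
      by (intro exI[of _ K] conjI exI[of _ i] exI[of _ "m - box_size (Suc n) K i"]) auto
  qed
next
  case (carry K)
  then show ?case by (simp add: box_size_full)
qed

lemma box_plus_cases:
  assumes "1 < m"
  obtains K i r where "1 \<le> K" "i \<le> n" "1 \<le> r" "r \<le> box_size n K i"
    "m = box_size (Suc n) K i + r"
proof -
  have "m \<le> box_size (Suc n) m 0" using assms by (simp add: box_size_def)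
  then show ?thesis
    using le_box_size_imp_box_plus[of m 0 n m] assms that by (metis One_nat_def less_imp_le zero_le)
qed

text \<open>
  The inequality \<open>j \<le> i\<close> for the deciding position \<open>j\<close> at level \<open>K\<close> is what makes a box with \<open>i\<close>
  long sides an initial segment: the order prefers to fill the positions with small index.
\<close>

lemma box_downward:
  assumes y: "y \<in> box n K i" and x: "x \<in> lattice_points n" and "cube_less n x y"
  shows "x \<in> box n K i"
proof -
  from assms(3) obtain j where j: "j \<in> {1..n}" "x j < y j"
    and above: "\<And>k. k \<in> {1..n} \<Longrightarrow> y j < x k \<Longrightarrow> x k = y k"
    and at: "\<And>k. k \<in> {1..n} \<Longrightarrow> j < k \<Longrightarrow> x k = y j \<longleftrightarrow> y k = y j"
    unfolding cube_less_pointwise by blast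
  have bound: "y k < (if k \<le> i then Suc K else K)" if "k \<in> {1..n}" for k
    using y that by (auto simp: box_def)
  have "x k < (if k \<le> i then Suc K else K)" if k: "k \<in> {1..n}" for k
  proof (cases "y j < x k")
    case True
    then show ?thesis using above[OF k] bound[OF k] by simp
  next
    case False
    then show ?thesis
      using at[OF k] bound[OF k] bound[OF j(1)] by (auto split: if_splits)
  qed
  then show ?thesis using x by (simp add: box_def)
qed

section \<open>Faces\<close>

text \<open>
  Precomposition with \<open>skip i\<close> forgets coordinate \<open>i + 1\<close>.
\<close>

definition skip :: "nat \<Rightarrow> nat \<Rightarrow> nat" where
  "skip i k = (if k \<le> i then k else Suc k)"

definition face_over :: "nat \<Rightarrow> nat \<Rightarrow> nat \<Rightarrow> (nat \<Rightarrow> nat) set \<Rightarrow> (nat \<Rightarrow> nat) set" where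
  "face_over n K i A = {x \<in> lattice_points (Suc n). x (Suc i) = K \<and> x \<circ> skip i \<in> A}"

lemma inj_skip: "inj (skip i)"
  by (auto simp: inj_def skip_def split: if_splits)

lemma skip_image:
  assumes "i \<le> n"
  shows "skip i ` {1..n} = {1..Suc n} - {Suc i}"
proof (intro equalityI subsetI)
  fix k assume k: "k \<in> {1..Suc n} - {Suc i}"
  show "k \<in> skip i ` {1..n}"
  proof (cases "k \<le> i")
    case True
    then show ?thesis using k assms by (intro image_eqI[of _ _ k]) (auto simp: skip_def)
  next
    case False
    then show ?thesis using k assms by (intro image_eqI[of _ _ "k - 1"]) (auto simp: skip_def)
  qed
qed (use assms in \<open>auto simp: skip_def split: if_splits\<close>)

lemma ball_skip:
  assumes "i \<le> n"
  shows "(\<forall>k\<in>{1..Suc n}. P k) \<longleftrightarrow> P (Suc i) \<and> (\<forall>k\<in>{1..n}. P (skip i k))"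
proof -
  have eq: "{1..Suc n} = insert (Suc i) (skip i ` {1..n})"
    unfolding skip_image[OF assms] using assms by auto
  show ?thesis unfolding eq by blast
qed

lemma zero_count_skip:
  assumes "i \<le> n" "x (Suc i) \<noteq> 0"
  shows "zero_count n (x \<circ> skip i) = zero_count (Suc n) x"
proof -
  have "{k\<in>{1..Suc n}. x k = 0} = {k\<in>{1..Suc n} - {Suc i}. x k = 0}"
    using assms(2) by force
  also have "\<dots> = skip i ` {k\<in>{1..n}. x (skip i k) = 0}"
    unfolding skip_image[OF assms(1), symmetric] by force
  finally show ?thesis
    unfolding zero_count_def using card_image[OF inj_on_subset[OF inj_skip]] by simp
qed

text \<open>
  A coordinate shared by two points never decides between them.
\<close>

lemma cube_less_skip:
  assumes i: "i \<le> n" and eq: "x (Suc i) = y (Suc i)" and "cube_less (Suc n) x y"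
  shows "cube_less n (x \<circ> skip i) (y \<circ> skip i)"
proof -
  from assms(3) obtain j where j: "j \<in> {1..Suc n}" "x j < y j"
    and above: "\<And>k. k \<in> {1..Suc n} \<Longrightarrow> y j < x k \<or> y j < y k \<Longrightarrow> x k = y k"
    and at: "\<And>k. k \<in> {1..Suc n} \<Longrightarrow> j < k \<Longrightarrow> x k = y j \<longleftrightarrow> y k = y j"
    unfolding cube_less_pointwise by blast
  have "j \<in> skip i ` {1..n}" using j eq skip_image[OF i] by auto
  then obtain j' where j': "j' \<in> {1..n}" "j = skip i j'" by auto
  have skip: "skip i k \<in> {1..Suc n}" if "k \<in> {1..n}" for k
    using skip_image[OF i] imageI[OF that, of "skip i"] by blast
  have mono: "j < skip i k" if "j' < k" for k
    using that j'(2) by (auto simp: skip_def)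
  show ?thesis
    unfolding cube_less_pointwise
    using j' j above[OF skip] at[OF skip mono] by (intro bexI[of _ j']) auto
qed

lemma skip_lattice_points:
  assumes "i \<le> n" "x \<in> lattice_points (Suc n)"
  shows "x \<circ> skip i \<in> lattice_points n"
  using assms by (auto simp: lattice_points_def skip_def)

text \<open>
  The section of \<open>\<lambda>x. x \<circ> skip i\<close> with constant value \<open>c\<close> at the forgotten coordinate.
\<close>

definition insert_coord :: "nat \<Rightarrow> nat \<Rightarrow> (nat \<Rightarrow> nat) \<Rightarrow> nat \<Rightarrow> nat" where
  "insert_coord i c y k = (if k \<le> i then y k else if k = Suc i then c else y (k - 1))"

lemma insert_coord_skip: "insert_coord i c y \<circ> skip i = y"
  by (auto simp: insert_coord_def skip_def fun_eq_iff)

lemma insert_coord_of_skip: "insert_coord i (x (Suc i)) (x \<circ> skip i) = x"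
  by (auto simp: insert_coord_def skip_def fun_eq_iff)

lemma insert_coord_lattice_points:
  assumes "i \<le> n" "y \<in> lattice_points n"
  shows "insert_coord i c y \<in> lattice_points (Suc n)"
  unfolding lattice_points_def
proof (intro CollectI allI impI)
  fix k assume k: "k \<notin> {1..Suc n}"
  have y: "y l = 0" if "l = 0 \<or> n < l" for l
    using assms(2) that by (auto simp: lattice_points_def)
  have "k = 0 \<or> Suc n < k" using k by auto
  then consider "k = 0" | "\<not> k \<le> i" "k \<noteq> Suc i" "n < k - 1" using assms(1) by linarith
  then show "insert_coord i c y k = 0"
  proof cases
    case 1
    then show ?thesis using y[of 0] by (simp add: insert_coord_def)
  next
    case 2
    then show ?thesis using y[of "k - 1"] by (simp add: insert_coord_def)
  qed
qed

lemma bij_betw_face_over: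
  assumes i: "i \<le> n" and A: "A \<subseteq> lattice_points n"
  shows "bij_betw (\<lambda>x. x \<circ> skip i) (face_over n K i A) A"
proof (rule bij_betw_byWitness[where f' = "insert_coord i K"])
  show "\<forall>x\<in>face_over n K i A. insert_coord i K (x \<circ> skip i) = x"
    unfolding face_over_def using insert_coord_of_skip by blast
  show "\<forall>y\<in>A. insert_coord i K y \<circ> skip i = y"
    by (simp add: insert_coord_skip)
  show "(\<lambda>x. x \<circ> skip i) ` face_over n K i A \<subseteq> A"
    by (auto simp: face_over_def)
  show "insert_coord i K ` A \<subseteq> face_over n K i A"
  proof
    fix x assume "x \<in> insert_coord i K ` A"
    then obtain y where y: "y \<in> A" "x = insert_coord i K y" by blast
    then have "x \<in> lattice_points (Suc n)" "x (Suc i) = K" "x \<circ> skip i = y"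
      using insert_coord_lattice_points[OF i] A insert_coord_skip
      by (auto simp: insert_coord_def)
    with y show "x \<in> face_over n K i A" by (simp add: face_over_def)
  qed
qed

lemma box_Suc:
  assumes "i \<le> n"
  shows "box (Suc n) K (Suc i) = box (Suc n) K i \<union> face_over n K i (box n K i)"
proof (rule set_eqI)
  fix x
  show "x \<in> box (Suc n) K (Suc i) \<longleftrightarrow>
      x \<in> box (Suc n) K i \<union> face_over n K i (box n K i)"
  proof (cases "x \<in> lattice_points (Suc n)")
    case True
    have le: "skip i k \<le> Suc i \<longleftrightarrow> k \<le> i" "skip i k \<le> i \<longleftrightarrow> k \<le> i" for k
      by (auto simp: skip_def)
    define R where "R \<longleftrightarrow> (\<forall>k\<in>{1..n}. x (skip i k) < (if k \<le> i then Suc K else K))"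
    have "x \<in> box (Suc n) K (Suc i) \<longleftrightarrow> x (Suc i) < Suc K \<and> R"
      "x \<in> box (Suc n) K i \<longleftrightarrow> x (Suc i) < K \<and> R"
      unfolding box_def ball_skip[OF assms] R_def using True by (simp_all only: le) simp_all
    moreover have "x \<in> face_over n K i (box n K i) \<longleftrightarrow> x (Suc i) = K \<and> R"
      using True skip_lattice_points[OF assms True] by (simp add: face_over_def box_def R_def)
    ultimately show ?thesis by (auto simp: less_Suc_eq)
  qed (auto simp: box_def face_over_def)
qed

lemma box_Int_face_over: "i \<le> n \<Longrightarrow> box (Suc n) K i \<inter> face_over n K i A = {}"
  by (force simp: box_def face_over_def)

lemma box_1: "box n 1 0 = {\<lambda>_. 0}"
proof -
  have "x = (\<lambda>_. 0)" if "x \<in> box n 1 0" for x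
  proof
    show "x k = 0" for k
      using that by (cases "k \<in> {1..n}") (auto simp: box_def lattice_points_def)
  qed
  moreover have "(\<lambda>_. 0) \<in> box n 1 0" by (auto simp: box_def lattice_points_def)
  ultimately show ?thesis by blast
qed

lemma finite_box_card_box:
  assumes "1 \<le> K" "i \<le> n"
  shows "finite (box n K i) \<and> card (box n K i) = box_size n K i"
  using assms
proof (induction n arbitrary: K i)
  case 0
  have "box 0 K 0 = box 0 1 0" by (auto simp: box_def)
  then show ?case using 0 box_1 by (simp add: box_size_def)
next
  case (Suc n)
  from Suc.prems show ?case
  proof (induction K i rule: box_induct)
    case start
    show ?case unfolding box_1 box_size_1 by simp
  next
    case (grow K i)
    then have i: "i \<le> n" by simp
    have bij: "bij_betw (\<lambda>x. x \<circ> skip i) (face_over n K i (box n K i)) (box n K i)"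
      by (rule bij_betw_face_over[OF i]) (auto simp: box_def)
    then show ?case
      using grow Suc.IH[of K i] box_Int_face_over[OF i]
        bij_betw_same_card[OF bij] bij_betw_finite[OF bij]
      by (simp add: box_Suc[OF i] box_size_Suc[OF i] card_Un_disjoint)
  next
    case (carry K)
    then show ?case by (simp add: box_full box_size_full)
  qed
qed

lemma initial_segment_box:
  assumes "1 \<le> K" "i \<le> n"
  shows "initial_segment n (box n K i)"
  unfolding initial_segment_def
proof (intro conjI ballI impI)
  show "finite (box n K i)" using finite_box_card_box[OF assms] by simp
  show "box n K i \<subseteq> lattice_points n" by (auto simp: box_def)
qed (rule box_downward)

section \<open>The recursive structure of initial segments\<close>

text \<open>
  Between two consecutive boxes the cube order fills the new face, on which it restricts to the
  cube order of one dimension less.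
\<close>

lemma initial_segment_box_Un_face:
  assumes K: "1 \<le> K" and i: "i \<le> n" and A: "initial_segment n A" and le: "card A \<le> box_size n K i"
  shows "initial_segment (Suc n) (box (Suc n) K i \<union> face_over n K i A)"
  unfolding initial_segment_def
proof (intro conjI ballI impI)
  have Asub: "A \<subseteq> box n K i"
    using A le K i initial_segment_box finite_box_card_box
    by (metis initial_segment_subset_if_card_le)
  have bij: "bij_betw (\<lambda>x. x \<circ> skip i) (face_over n K i A) A"
    by (rule bij_betw_face_over[OF i]) (use A in \<open>simp add: initial_segment_def\<close>)
  show "finite (box (Suc n) K i \<union> face_over n K i A)"
    using finite_box_card_box[of K i "Suc n"] bij_betw_finite[OF bij] A K i
    by (simp add: initial_segment_def)
  show "box (Suc n) K i \<union> face_over n K i A \<subseteq> lattice_points (Suc n)"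
    by (auto simp: box_def face_over_def)
  fix y x
  assume y: "y \<in> box (Suc n) K i \<union> face_over n K i A"
    and x: "x \<in> lattice_points (Suc n)" and less: "cube_less (Suc n) x y"
  from y show "x \<in> box (Suc n) K i \<union> face_over n K i A"
  proof
    assume "y \<in> box (Suc n) K i"
    then show ?thesis using x less box_downward by blast
  next
    assume yF: "y \<in> face_over n K i A"
    then have "y \<in> box (Suc n) K (Suc i)"
      unfolding box_Suc[OF i] using Asub by (auto simp: face_over_def)
    then have "x \<in> box (Suc n) K (Suc i)" using x less box_downward by blast
    then consider "x \<in> box (Suc n) K i" | "x (Suc i) = K"
      unfolding box_Suc[OF i] by (auto simp: face_over_def)
    then show ?thesis
    proof cases
      case 2
      with yF have "cube_less n (x \<circ> skip i) (y \<circ> skip i)"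
        by (intro cube_less_skip[OF i _ less]) (simp add: face_over_def)
      then have "x \<circ> skip i \<in> A"
        using A yF skip_lattice_points[OF i x] by (auto simp: initial_segment_def face_over_def)
      then show ?thesis using x 2 by (simp add: face_over_def)
    qed simp
  qed
qed

lemma card_box_Un_face:
  assumes "1 \<le> K" and i: "i \<le> n" and A: "initial_segment n A"
  shows "card (box (Suc n) K i \<union> face_over n K i A) = box_size (Suc n) K i + card A"
proof -
  have bij: "bij_betw (\<lambda>x. x \<circ> skip i) (face_over n K i A) A"
    by (rule bij_betw_face_over[OF i]) (use A in \<open>simp add: initial_segment_def\<close>)
  then show ?thesis
    using finite_box_card_box[of K i "Suc n"] assms box_Int_face_over[OF i]
      bij_betw_same_card[OF bij] bij_betw_finite[OF bij]
    by (simp add: card_Un_disjoint initial_segment_def)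
qed

lemma proj_sum_box_Un_face:
  assumes K: "1 \<le> K" and i: "i \<le> n" and A: "initial_segment n A" and le: "card A \<le> box_size n K i"
  shows "proj_sum (Suc n) (box (Suc n) K i \<union> face_over n K i A) =
    proj_sum (Suc n) (box (Suc n) K i) + proj_sum n A"
proof -
  have bij: "bij_betw (\<lambda>x. x \<circ> skip i) (face_over n K i A) A"
    by (rule bij_betw_face_over[OF i]) (use A in \<open>simp add: initial_segment_def\<close>)
  have box: "initial_segment (Suc n) (box (Suc n) K i)" using K i by (simp add: initial_segment_box)
  have "(\<Sum>x\<in>face_over n K i A. zero_count (Suc n) x) =
      (\<Sum>x\<in>face_over n K i A. zero_count n (x \<circ> skip i))"
    using K i by (intro sum.cong refl) (auto simp: face_over_def zero_count_skip)
  also have "\<dots> = (\<Sum>y\<in>A. zero_count n y)"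
    by (rule sum.reindex_bij_betw[OF bij])
  finally have "(\<Sum>x\<in>box (Suc n) K i \<union> face_over n K i A. zero_count (Suc n) x) =
      (\<Sum>x\<in>box (Suc n) K i. zero_count (Suc n) x) + (\<Sum>y\<in>A. zero_count n y)"
    using box A bij_betw_finite[OF bij] box_Int_face_over[OF i]
    by (simp add: sum.union_disjoint initial_segment_def)
  then show ?thesis
    using initial_segment_box_Un_face[OF assms] box A by (simp add: proj_sum_initial_segment)
qed

text \<open>
  The space of dimension \<open>0\<close> is a single point, so there only the sizes \<open>0\<close> and \<open>1\<close> occur.
\<close>

lemma initial_segment_exists:
  assumes "1 \<le> n \<or> m \<le> 1"
  shows "\<exists>I. initial_segment n I \<and> card I = m"
  using assms
proof (induction n arbitrary: m)
  case 0
  have "initial_segment 0 (box 0 1 0)" "card (box 0 1 0) = 1"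
    using initial_segment_box[of 1 0 0] by (simp_all add: box_1[unfolded One_nat_def])
  moreover have "m = 0 \<or> m = 1" using 0 by auto
  ultimately show ?case using initial_segment_empty by (metis card.empty)
next
  case (Suc n)
  consider "m = 0" | "m = 1" | "1 < m" by linarith
  then show ?case
  proof cases
    case 1
    then show ?thesis using initial_segment_empty by (metis card.empty)
  next
    case 2
    have "initial_segment (Suc n) (box (Suc n) 1 0)" "card (box (Suc n) 1 0) = 1"
      using initial_segment_box[of 1 0 "Suc n"] by (simp_all add: box_1[unfolded One_nat_def])
    with 2 show ?thesis by blast
  next
    case 3
    then obtain K i r where *: "1 \<le> K" "i \<le> n" "1 \<le> r" "r \<le> box_size n K i"
      "m = box_size (Suc n) K i + r" by (rule box_plus_cases)
    then have "1 \<le> n \<or> r \<le> 1" by (cases n) (auto simp: box_size_def)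
    then obtain A where "initial_segment n A" "card A = r" using Suc.IH by blast
    then show ?thesis
      using * initial_segment_box_Un_face[of K i n A] card_box_Un_face[of K i n A] by metis
  qed
qed

definition segment :: "nat \<Rightarrow> nat \<Rightarrow> (nat \<Rightarrow> nat) set" where
  "segment n m = (SOME I. initial_segment n I \<and> card I = m)"

definition seg_sum :: "nat \<Rightarrow> nat \<Rightarrow> nat" where
  "seg_sum n m = proj_sum n (segment n m)"

lemma proj_sum_eq_seg_sum:
  assumes "initial_segment n I"
  shows "proj_sum n I = seg_sum n (card I)"
proof -
  have "initial_segment n (segment n (card I)) \<and> card (segment n (card I)) = card I"
    unfolding segment_def by (rule someI[where x = I]) (simp add: assms)
  then show ?thesis
    using initial_segment_eq_if_card_eq[OF assms, of "segment n (card I)"]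
    by (simp add: seg_sum_def)
qed

text \<open>
  This includes the sizes \<open>m > 1\<close>, which no segment of dimension \<open>0\<close> has: a sum over no axes
  vanishes for every set. So the induction on the dimension can start at \<open>0\<close>.
\<close>

lemma seg_sum_dim_0: "seg_sum 0 m = 0"
  by (simp add: seg_sum_def proj_sum_def)

lemma seg_sum_0: "seg_sum n 0 = 0"
  using proj_sum_eq_seg_sum[OF initial_segment_empty, of n] by (simp add: proj_sum_def)

lemma seg_sum_1: "seg_sum n 1 = n"
  using proj_sum_eq_seg_sum[OF initial_segment_box[of 1 0 n]]
  by (simp add: box_1[unfolded One_nat_def] proj_sum_def)

lemma seg_sum_box_plus:
  assumes K: "1 \<le> K" and i: "i \<le> n" and r: "r \<le> box_size n K i"
  shows "seg_sum (Suc n) (box_size (Suc n) K i + r) =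
    seg_sum (Suc n) (box_size (Suc n) K i) + seg_sum n r"
proof -
  have "1 \<le> n \<or> r \<le> 1" using i r by (cases n) (auto simp: box_size_def)
  then obtain A where A: "initial_segment n A" "card A = r" using initial_segment_exists by blast
  have "initial_segment (Suc n) (box (Suc n) K i)" "card (box (Suc n) K i) = box_size (Suc n) K i"
    using K i initial_segment_box finite_box_card_box by auto
  then show ?thesis
    using proj_sum_box_Un_face[of K i n A] initial_segment_box_Un_face[of K i n A]
      card_box_Un_face[of K i n A] A assms
    by (metis proj_sum_eq_seg_sum)
qed

section \<open>The three inequalities\<close>

text \<open>
  The window form is recovered by writing \<open>c\<close> for the size of the box and \<open>t = a - d = c - b\<close>: the
  points from \<open>d\<close> to \<open>d + t\<close> contribute at least as much as those from \<open>c - t\<close> to \<open>c\<close>.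
\<close>

definition box_exchange :: "nat \<Rightarrow> bool" where
  "box_exchange n \<longleftrightarrow> (\<forall>K i a b d. 1 \<le> K \<longrightarrow> i \<le> n \<longrightarrow>
    a \<le> box_size n K i \<longrightarrow> b \<le> box_size n K i \<longrightarrow> a + b = d + box_size n K i \<longrightarrow>
    seg_sum n d + seg_sum n (box_size n K i) \<le> seg_sum n a + seg_sum n b)"

definition subadditive :: "nat \<Rightarrow> bool" where
  "subadditive n \<longleftrightarrow> (\<forall>a b. seg_sum n (a + b) \<le> seg_sum n a + seg_sum n b)"

lemma box_exchangeD:
  assumes "box_exchange n" "1 \<le> K" "i \<le> n" "a \<le> box_size n K i" "b \<le> box_size n K i"
    "a + b = d + box_size n K i"
  shows "seg_sum n d + seg_sum n (box_size n K i) \<le> seg_sum n a + seg_sum n b"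
  using assms unfolding box_exchange_def by blast

lemma subadditiveD: "subadditive n \<Longrightarrow> seg_sum n (a + b) \<le> seg_sum n a + seg_sum n b"
  unfolding subadditive_def by blast

text \<open>
  Splitting off the last, possibly incomplete, face costs the same amount in both dimensions, up to
  subadditivity in the lower one; what remains is a box, to which induction on the size applies.
\<close>

lemma seg_sum_less_dim_Suc:
  assumes "subadditive n" "1 \<le> m"
  shows "seg_sum n m < seg_sum (Suc n) m"
  using assms(2)
proof (induction m rule: less_induct)
  case (less m)
  show ?case
  proof (cases "m = 1")
    case True
    show ?thesis unfolding True seg_sum_1 by simp
  next
    case False
    with less.prems have "1 < m" by simp
    then obtain K i r where *: "1 \<le> K" "i \<le> n" "1 \<le> r" "r \<le> box_size n K i"
      "m = box_size (Suc n) K i + r" by (rule box_plus_cases)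
    let ?c = "box_size (Suc n) K i"
    have "seg_sum n m \<le> seg_sum n ?c + seg_sum n r"
      unfolding *(5) by (rule subadditiveD[OF assms(1)])
    also have "seg_sum n ?c < seg_sum (Suc n) ?c"
      using * by (intro less.IH) (auto simp: box_size_def Suc_le_eq)
    also have "seg_sum (Suc n) ?c + seg_sum n r = seg_sum (Suc n) m"
      using * by (simp add: seg_sum_box_plus)
    finally show ?thesis by simp
  qed
qed

text \<open>
  Let the last face before the end of a box in dimension \<open>n + 1\<close> have size at most \<open>g + t\<close>, the size
  of a box in dimension \<open>n\<close>. Then every window of length \<open>t\<close> inside the large box contributes at
  least as much as the last \<open>t\<close> points of the small one. The proof removes faces from the end of the
  window. A part filling an initial piece of a face is replaced, by subadditivity, with a piece of
  the tail of the small box; a window inside a single face is compared with the tail by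
  \<^const>\<open>box_exchange\<close>, as the segment of that face fits into the small box. The last face of the
  box with parameters \<open>K\<close> and \<open>i > 0\<close> has size \<open>box_size n K (i - 1)\<close>; for \<open>i = 0\<close> this
  expression is \<open>K ^ n\<close>, the size of the last face of the same cube with parameters \<open>K - 1\<close> and
  \<open>n + 1\<close>.
\<close>

lemma window_ge_tail:
  assumes exch: "box_exchange n" and sub: "subadditive n"
    and "1 \<le> K" "i \<le> Suc n"
    and F: "1 \<le> L" "j \<le> n" "g + t = box_size n L j"
    and "box_size n K (i - 1) \<le> g + t" "a + t \<le> box_size (Suc n) K i"
  shows "seg_sum n (g + t) + seg_sum (Suc n) a \<le> seg_sum (Suc n) (a + t) + seg_sum n g"
  using assms(3,4,8,9) F(3)
proof (induction K i arbitrary: a t g rule: box_induct)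
  case start
  then have "a + t \<le> 1" unfolding box_size_1 by simp
  then consider "t = 0" | "a = 0" "t = 1" by linarith
  then show ?case
  proof cases
    case 2
    have "seg_sum n (g + 1) \<le> seg_sum n g + seg_sum n 1" by (rule subadditiveD[OF sub])
    also have "seg_sum n 1 \<le> seg_sum (Suc n) 1" by (simp only: seg_sum_1)
    finally show ?thesis using 2 by (simp add: seg_sum_0)
  qed simp
next
  case (grow K i)
  then have i: "i \<le> n" by simp
  have prev: "box_size n K (i - 1) \<le> g + t"
    using grow.prems(1) box_size_le_Suc[of "i - 1" n K] i by (cases i) auto
  let ?c = "box_size (Suc n) K i"
  show ?case
  proof (cases "a + t \<le> ?c")
    case True
    show ?thesis by (rule grow.IH[OF prev True grow.prems(3)])
  next
    case False
    \<comment> \<open>The number of points of the last face that precede the end of the window.\<close>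
    define v where "v = a + t - ?c"
    have v: "a + t = ?c + v" "v \<le> box_size n K i"
      using False grow.prems(2) box_size_Suc[OF i, of K] by (auto simp: v_def)
    have at: "seg_sum (Suc n) (a + t) = seg_sum (Suc n) ?c + seg_sum n v"
      unfolding v(1) using grow.hyps i v(2) by (simp add: seg_sum_box_plus)
    show ?thesis
    proof (cases "t \<le> v")
      case True
      \<comment> \<open>The window lies on the last face and starts at the \<open>w\<close>-th point of it.\<close>
      define w where "w = v - t"
      have w: "v = w + t" "a = ?c + w" using True v by (auto simp: w_def)
      have "seg_sum (Suc n) a = seg_sum (Suc n) ?c + seg_sum n w"
        unfolding w(2) using grow.hyps i v w by (intro seg_sum_box_plus) auto
      moreover have "seg_sum n w + seg_sum n (box_size n L j) \<le> seg_sum n v + seg_sum n g"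
        using grow.prems v w F by (intro box_exchangeD[OF exch]) auto
      ultimately show ?thesis using at grow.prems(3) by simp
    next
      case False
      \<comment> \<open>The first \<open>u\<close> points of the window precede the last face. They are matched with the last
        \<open>u\<close> points of the small box, and the other \<open>v\<close> with the \<open>v\<close> points before these.\<close>
      define u where "u = t - v"
      have u: "t = u + v" "a + u = ?c" using False v by (auto simp: u_def)
      have "seg_sum n (g + v + u) + seg_sum (Suc n) a \<le> seg_sum (Suc n) (a + u) + seg_sum n (g + v)"
        using prev grow.prems(3) u by (intro grow.IH) (auto simp: add_ac)
      moreover have "seg_sum n (g + v) \<le> seg_sum n g + seg_sum n v"
        by (rule subadditiveD[OF sub])
      ultimately show ?thesis using at u by (simp add: add_ac)
    qed
  qed
next
  case (carry K)
  then show ?case by (simp add: box_size_full)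
qed

text \<open>
  Let \<open>p\<close> be the size of the preceding box and \<open>f\<close> that of the last face. If one of the summands is at
  least \<open>p\<close>, the tail in question lies on the last face, and the comparison of windows applies.
  Otherwise the exchange is made in two steps: first towards \<open>p\<close> and \<open>d + f\<close>, by induction, and then
  by moving a full window of length \<open>f\<close> onto the last face.
\<close>

lemma box_exchange_Suc:
  assumes exch: "box_exchange n" and sub: "subadditive n"
  shows "box_exchange (Suc n)"
  unfolding box_exchange_def
proof (intro allI impI)
  fix K i a b d
  assume "1 \<le> K" "i \<le> Suc n" "a \<le> box_size (Suc n) K i" "b \<le> box_size (Suc n) K i"
    "a + b = d + box_size (Suc n) K i"
  then show "seg_sum (Suc n) d + seg_sum (Suc n) (box_size (Suc n) K i) \<le>
      seg_sum (Suc n) a + seg_sum (Suc n) b"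
  proof (induction K i arbitrary: a b d rule: box_induct)
    case start
    then have "a \<le> 1" "b \<le> 1" "a + b = d + 1" unfolding box_size_1 by auto
    then have "a = 1 \<and> d = b \<or> b = 1 \<and> d = a" by linarith
    then show ?case unfolding box_size_1 by auto
  next
    case (grow K i)
    then have i: "i \<le> n" by simp
    let ?p = "box_size (Suc n) K i" and ?f = "box_size n K i"
    have c: "box_size (Suc n) K (Suc i) = ?p + ?f" by (rule box_size_Suc[OF i])
    have sc: "seg_sum (Suc n) (?p + ?f) = seg_sum (Suc n) ?p + seg_sum n ?f"
      using grow.hyps i by (simp add: seg_sum_box_plus)
    have window: "seg_sum n ?f + seg_sum (Suc n) x \<le> seg_sum (Suc n) (x + t) + seg_sum n g"
      if "g + t = ?f" "x + t \<le> ?p + ?f" for x t g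
      using window_ge_tail[OF exch sub, of K "Suc i" K i g t x] grow.hyps i that c by simp
    have beyond: "seg_sum (Suc n) d + seg_sum (Suc n) (?p + ?f) \<le> seg_sum (Suc n) x + seg_sum (Suc n) y"
      if "x \<le> ?p + ?f" "?p \<le> y" "y \<le> ?p + ?f" "x + y = d + (?p + ?f)" for x y
    proof -
      obtain r where r: "y = ?p + r" using \<open>?p \<le> y\<close> le_Suc_ex by blast
      have "seg_sum (Suc n) y = seg_sum (Suc n) ?p + seg_sum n r"
        unfolding r using grow.hyps i that r by (intro seg_sum_box_plus) auto
      moreover have "x = d + (?f - r)" "r + (?f - r) = ?f" using that r by auto
      then have "seg_sum n ?f + seg_sum (Suc n) d \<le> seg_sum (Suc n) x + seg_sum n r"
        using window[of r "?f - r" d] that by simp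
      ultimately show ?thesis using sc by simp
    qed
    show ?case
    proof (cases "?p \<le> b \<or> ?p \<le> a")
      case True
      then show ?thesis
        using beyond[of a b] beyond[of b a] grow.prems c by (auto simp: add_ac)
    next
      case False
      have "seg_sum (Suc n) (d + ?f) + seg_sum (Suc n) ?p \<le> seg_sum (Suc n) a + seg_sum (Suc n) b"
        using False grow.prems c by (intro grow.IH) auto
      moreover have "seg_sum n ?f + seg_sum (Suc n) d \<le> seg_sum (Suc n) (d + ?f)"
        using window[of 0 ?f d] False grow.prems c by (simp add: seg_sum_0)
      ultimately show ?thesis using sc c by simp
    qed
  next
    case (carry K)
    then show ?case by (simp add: box_size_full)
  qed
qed

text \<open>
  Strictness always comes from the comparison of dimensions: at some point a non-empty initial window
  of dimension \<open>n\<close> is weighed against the initial window of the same length in dimension \<open>n + 1\<close>.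
\<close>

lemma seg_sum_add_less:
  assumes exch: "box_exchange (Suc n)" and sub: "subadditive n" and "1 \<le> a" "1 \<le> b"
  shows "seg_sum (Suc n) (a + b) < seg_sum (Suc n) a + seg_sum (Suc n) b"
proof -
  from assms have "1 < a + b" by simp
  then obtain K i r where *: "1 \<le> K" "i \<le> n" "1 \<le> r" "r \<le> box_size n K i"
    "a + b = box_size (Suc n) K i + r" by (rule box_plus_cases)
  let ?p = "box_size (Suc n) K i"
  have ab: "seg_sum (Suc n) (a + b) = seg_sum (Suc n) ?p + seg_sum n r"
    unfolding *(5) using * by (simp add: seg_sum_box_plus)
  have beyond: "seg_sum (Suc n) (a + b) < seg_sum (Suc n) x + seg_sum (Suc n) y"
    if "1 \<le> x" "?p \<le> y" "x + y = a + b" for x y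
  proof -
    obtain s where s: "y = ?p + s" using \<open>?p \<le> y\<close> le_Suc_ex by blast
    have "r = s + x" using s that * by simp
    then have "seg_sum n r \<le> seg_sum n s + seg_sum n x" using subadditiveD[OF sub] by simp
    also have "seg_sum n x < seg_sum (Suc n) x" by (rule seg_sum_less_dim_Suc[OF sub \<open>1 \<le> x\<close>])
    finally have "seg_sum n r < seg_sum n s + seg_sum (Suc n) x" by simp
    moreover have "seg_sum (Suc n) y = seg_sum (Suc n) ?p + seg_sum n s"
      unfolding s using * \<open>r = s + x\<close> by (intro seg_sum_box_plus) auto
    ultimately show ?thesis using ab by simp
  qed
  show ?thesis
  proof (cases "?p \<le> b \<or> ?p \<le> a")
    case True
    then show ?thesis using beyond[of a b] beyond[of b a] assms by (auto simp: add_ac)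
  next
    case False
    have "seg_sum (Suc n) r + seg_sum (Suc n) ?p \<le> seg_sum (Suc n) a + seg_sum (Suc n) b"
      using False * by (intro box_exchangeD[OF exch]) auto
    moreover have "seg_sum n r < seg_sum (Suc n) r"
      by (rule seg_sum_less_dim_Suc[OF sub \<open>1 \<le> r\<close>])
    ultimately show ?thesis using ab by simp
  qed
qed

lemma box_exchange_and_subadditive: "box_exchange n \<and> subadditive n"
proof (induction n)
  case 0
  show ?case by (simp add: box_exchange_def subadditive_def seg_sum_dim_0)
next
  case (Suc n)
  then have exch: "box_exchange (Suc n)" by (intro box_exchange_Suc) auto
  have "seg_sum (Suc n) (a + b) \<le> seg_sum (Suc n) a + seg_sum (Suc n) b" for a b
  proof (cases "a = 0 \<or> b = 0")
    case False
    then show ?thesis using seg_sum_add_less[OF exch, of a b] Suc by simp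
  qed auto
  with exch show ?case by (simp add: subadditive_def)
qed

theorem lemma1:
  fixes n :: nat
  assumes "n \<ge> 1"
  shows
    "(\<forall>I1 I2 J1 J2.
        initial_segment n I1 \<and> initial_segment n I2 \<and>
        initial_segment n J1 \<and> initial_segment n J2 \<and>
        card I1 + card I2 = card J1 + card J2 \<and>
        card J1 \<le> card I1 \<and> card I1 \<le> card I2 \<and> card I2 \<le> card J2 \<and>
        closed_initial_segment n J2 \<longrightarrow>
        proj_sum n J1 + proj_sum n J2 \<le> proj_sum n I1 + proj_sum n I2) \<and>
     (\<forall>I I1 I2.
        initial_segment n I \<and> initial_segment n I1 \<and> initial_segment n I2 \<and>
        I \<noteq> {} \<and> I1 \<noteq> {} \<and> I2 \<noteq> {} \<and>
        card I = card I1 + card I2 \<longrightarrow>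
        proj_sum n I < proj_sum n I1 + proj_sum n I2) \<and>
     (n \<ge> 2 \<longrightarrow>
       (\<forall>I' I.
          initial_segment (n - 1) I' \<and> initial_segment n I \<and>
          I' \<noteq> {} \<and> I \<noteq> {} \<and> card I' = card I \<longrightarrow>
          proj_sum n I > proj_sum (n - 1) I'))"
proof -
  obtain n' where n: "n = Suc n'" using assms by (cases n) auto
  have exch: "box_exchange n" and sub: "subadditive n'"
    using box_exchange_and_subadditive by auto
  show ?thesis
  proof (intro conjI allI impI; elim conjE)
    fix I1 I2 J1 J2
    assume I: "initial_segment n I1" "initial_segment n I2"
      and J: "initial_segment n J1" "initial_segment n J2"
      and sum: "card I1 + card I2 = card J1 + card J2"
      and le: "card J1 \<le> card I1" "card I1 \<le> card I2" "card I2 \<le> card J2"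
      and "closed_initial_segment n J2"
    then obtain K i where "1 \<le> K" "i \<in> {0..n - 1}" "card J2 = (K + 1) ^ i * K ^ (n - i)"
      unfolding closed_initial_segment_def by blast
    then have Ki: "1 \<le> K" "i \<le> n" "card J2 = box_size n K i"
      by (auto simp: box_size_def)
    then have "seg_sum n (card J1) + seg_sum n (card J2) \<le> seg_sum n (card I1) + seg_sum n (card I2)"
      using box_exchangeD[OF exch, of K i "card I1" "card I2" "card J1"] le sum by simp
    then show "proj_sum n J1 + proj_sum n J2 \<le> proj_sum n I1 + proj_sum n I2"
      using I J by (simp add: proj_sum_eq_seg_sum)
  next
    fix I I1 I2
    assume I: "initial_segment n I" "initial_segment n I1" "initial_segment n I2"
      and ne: "I1 \<noteq> {}" "I2 \<noteq> {}" and card: "card I = card I1 + card I2"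
    have "1 \<le> card I1" "1 \<le> card I2"
      using I ne by (auto simp: Suc_le_eq card_gt_0_iff initial_segment_def)
    then show "proj_sum n I < proj_sum n I1 + proj_sum n I2"
      using seg_sum_add_less[of n' "card I1" "card I2"] exch sub n I card
      by (simp add: proj_sum_eq_seg_sum)
  next
    fix I' I
    assume I: "initial_segment (n - 1) I'" "initial_segment n I"
      and "I \<noteq> {}" and card: "card I' = card I"
    then have "1 \<le> card I"
      by (auto simp: Suc_le_eq card_gt_0_iff initial_segment_def)
    then show "proj_sum (n - 1) I' < proj_sum n I"
      using seg_sum_less_dim_Suc[OF sub, of "card I"] n I card by (simp add: proj_sum_eq_seg_sum)
  qed
qed

end
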